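(* Let $n\ge 2$ and let $Z:=(e^n,e^1,e^2,\ldots,e^{n-1})\in\mathbf{M}_n(\mathbb{R})$ be the matrix whose columns are, in order, $e^n,e^1,e^2,\ldots,e^{n-1}$, where $e^k$ denotes the $k$-th standard basis vector of $\mathbb{R}^n$. Let $\alpha_1,\alpha_2,\ldots,\alpha_n$ be nonpositive real numbers and let $$A:=\alpha_1 I+\alpha_2 Z+\cdots+\alpha_n Z^{n-1}.$$ Then the following are equivalent: (1) $A$ is nonsingular and $A^{-1}$ is an $N$-matrix with $\mathcal{D}(A^{-1})$ being the simple $n$-cycle $v_1\rightarrow v_2\rightarrow\cdots\rightarrow v_n\rightarrow v_1$, with loops. (2) $A<0$ and the following hold: (a) $\alpha_2<\alpha_1<0$; (b) $\alpha_r=(\alpha_2)^{r-1}/(\alpha_1)^{r-2}$ for $r=3,\ldots,n$.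
   Context: $\mathbf{M}_n(\mathbb{R})$ is the set of real $n\times n$ matrices. For a matrix $X$, $X\ge 0$ means that all entries of $X$ are nonnegative, and $X<0$ means that all entries of $X$ are negative. $\rho(X)$ denotes the spectral radius of $X$. A matrix $X=(x_{ij})\in\mathbf{M}_n(\mathbb{R})$ is a $Z$-matrix if $x_{ij}\le 0$ for all $i\neq j$; equivalently, $X=tI-B$ for some $t\in\mathbb{R}$ and some $B\ge 0$. For $B\ge 0$ and $1\le r\le n$, let $\rho_r(B):=\max\{\rho(\hat B): \hat B \text{ is a principal submatrix of } B \text{ of order } r\}$. For $n\ge 2$, a $Z$-matrix $X=tI-B$ ($B\ge 0$) is an $N$-matrix if $\rho_{n-1}(B)<t<\rho(B)$. (This does not depend on the chosen representation.) For $X=(x_{ij})\in\mathbf{M}_n(\mathbb{R})$, the digraph $\mathcal{D}(X)$ has vertex set $\{v_1,\ldots,v_n\}$, and $(v_i,v_j)$ is a directed edge exactly when $x_{ij}\neq 0$ (loops are allowed). That $\mathcal{D}(X)$ is the simple $n$-cycle $v_1\rightarrow v_2\rightarrow\cdots\rightarrow v_n\rightarrow v_1$ with loops means that its edges are exactly $(v_i,v_{i+1})$ for $1\le i\le n-1$, $(v_n,v_1)$, and the loops $(v_i,v_i)$ for $1\le i\le n$; equivalently, the entries $x_{ii}$ ($1\le i\le n$), $x_{i,i+1}$ ($1\le i\le n-1$) and $x_{n1}$ are nonzero and all other entries of $X$ are zero. *)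

theory Defs
  imports
    "Jordan_Normal_Form.Spectral_Radius"
    "Jordan_Normal_Form.DL_Submatrix"
    "Graph_Theory.Pair_Digraph"
begin

(* Matrix indices and digraph vertices run over {0..<n}: v_i is the number i - 1. *)

(* The library's spectral radius is defined for complex matrices; the eigenvalues of a real
   matrix are its complex ones. *)
definition rho :: "real mat \<Rightarrow> real" where
  "rho X = spectral_radius (map_mat complex_of_real X)"

definition nonneg_mat :: "real mat \<Rightarrow> bool" where
  "nonneg_mat X \<longleftrightarrow> (\<forall>x \<in> elements_mat X. 0 \<le> x)"

definition neg_mat :: "real mat \<Rightarrow> bool" where
  "neg_mat X \<longleftrightarrow> (\<forall>x \<in> elements_mat X. x < 0)"

definition rho_principal :: "nat \<Rightarrow> real mat \<Rightarrow> real" where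
  "rho_principal r B =
     Max {rho (submatrix B I I) | I. I \<subseteq> {0..<dim_row B} \<and> card I = r}"

definition Z_matrix :: "nat \<Rightarrow> real mat \<Rightarrow> bool" where
  "Z_matrix n X \<longleftrightarrow>
     X \<in> carrier_mat n n \<and> (\<forall>i<n. \<forall>j<n. i \<noteq> j \<longrightarrow> X $$ (i, j) \<le> 0)"

(* The bounds on t do not depend on the representation X = t I - B with B nonnegative: two of
   them differ by replacing t with t + s and B with B + s I for some s \<ge> 0, which adds s to
   every spectral radius involved (Perron-Frobenius). *)
definition N_matrix :: "nat \<Rightarrow> real mat \<Rightarrow> bool" where
  "N_matrix n X \<longleftrightarrow>
     n \<ge> 2 \<and> Z_matrix n X \<and>
     (\<exists>t B. B \<in> carrier_mat n n \<and> nonneg_mat B \<and> X = t \<cdot>\<^sub>m 1\<^sub>m n - B \<and>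
        rho_principal (n - 1) B < t \<and> t < rho B)"

definition digraph_of_mat :: "nat \<Rightarrow> real mat \<Rightarrow> nat pair_pre_digraph" where
  "digraph_of_mat n X =
     \<lparr> pverts = {0..<n}, parcs = {(i, j). i < n \<and> j < n \<and> X $$ (i, j) \<noteq> 0} \<rparr>"

definition cycle_with_loops :: "nat \<Rightarrow> nat pair_pre_digraph" where
  "cycle_with_loops n =
     \<lparr> pverts = {0..<n},
       parcs = {(i, i + 1) | i. i + 1 < n} \<union> {(n - 1, 0)} \<union> {(i, i) | i. i < n} \<rparr>"

end

theory Submission
  imports Defs
begin

text \<open>
  \<open>Z\<close> is the cyclic shift, so \<open>A\<close> is the circulant matrix whose first row is
  \<open>\<alpha> 1, \<dots>, \<alpha> n\<close>. Circulants are exactly the matrices that commute with the shift, and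
  therefore the inverse of a circulant is a circulant (\<open>shift_invariant_inverse\<close>).
  A circulant whose digraph is the cycle with loops has the form \<open>a I + b Z\<close> with \<open>a\<close> and \<open>b\<close>
  nonzero, so the condition on the inverse says that \<open>A\<close> is the inverse of such a matrix which is
  moreover an \<open>N\<close>-matrix.

  The \<open>N\<close>-matrix condition is decided by \<open>a\<close> and \<open>b\<close> alone: \<open>a I + b Z\<close> is an \<open>N\<close>-matrix iff
  \<open>0 < a < - b\<close> (\<open>N_matrix_shift_pencil_iff\<close>). For \<open>B = s I + c Z\<close> with \<open>s, c \<ge> 0\<close> the
  constant vector and the constant row sums show that \<open>\<rho> B = s + c\<close>, while deleting a vertex destroys the only cycle of
  the digraph other than the loops, so that the principal submatrices of order \<open>n - 1\<close> have spectral
  radius \<open>s\<close>.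

  Finally, comparing entries in \<open>(a I + b Z) A = I\<close> gives \<open>a \<alpha>(d+1) + b \<alpha>(d) = 0\<close> for
  \<open>1 \<le> d < n\<close> and \<open>a \<alpha>(1) + b \<alpha>(n) = 1\<close>. The first family says that \<open>\<alpha>\<close> is geometric with
  ratio \<open>q = - b / a\<close>, and the last equation becomes \<open>a \<alpha>(1) (1 - q\<^sup>n) = 1\<close>. Under these relations
  \<open>0 < a < - b\<close> corresponds to \<open>q > 1\<close> and \<open>\<alpha>(1) < 0\<close>, that is, to \<open>\<alpha>(2) < \<alpha>(1) < 0\<close>
  (\<open>pencil_equations_solvable_iff\<close>). All entries of \<open>A\<close> are then negative.
\<close>

section \<open>The cyclic shift and circulant matrices\<close>

definition cyclic_shift :: "nat \<Rightarrow> real mat" where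
  "cyclic_shift n = mat n n (\<lambda>(i, j). if j = (i + 1) mod n then 1 else 0)"

lemma cyclic_shift_carrier [simp]:
  "cyclic_shift n \<in> carrier_mat n n" "dim_row (cyclic_shift n) = n" "dim_col (cyclic_shift n) = n"
  by (auto simp: cyclic_shift_def)

lemma cyclic_shift_index:
  "i < n \<Longrightarrow> j < n \<Longrightarrow> cyclic_shift n $$ (i, j) = (if j = (i + 1) mod n then 1 else 0)"
  by (simp add: cyclic_shift_def)

lemma mat_of_cols_unit_vecs_eq_cyclic_shift:
  assumes "n \<ge> 2"
  shows "mat_of_cols n (unit_vec n (n - 1) # map (unit_vec n) [0..<n - 1]) = cyclic_shift n"
    (is "mat_of_cols n ?cs = _")
proof (rule eq_matI)
  fix i j assume "i < dim_row (cyclic_shift n)" "j < dim_col (cyclic_shift n)"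
  hence ij: "i < n" "j < n" by auto
  have "mat_of_cols n ?cs $$ (i, j) = ?cs ! j $ i"
    using ij by (intro mat_of_cols_index) auto
  also have "\<dots> = cyclic_shift n $$ (i, j)"
  proof (cases j)
    case 0
    thus ?thesis using ij by (auto simp: cyclic_shift_index mod_Suc)
  next
    case (Suc k)
    thus ?thesis using ij by (auto simp: cyclic_shift_index mod_Suc)
  qed
  finally show "mat_of_cols n ?cs $$ (i, j) = cyclic_shift n $$ (i, j)" .
qed (use assms in auto)

lemma cyclic_shift_mult_index:
  assumes "M \<in> carrier_mat n m" "i < n" "j < m"
  shows "(cyclic_shift n * M) $$ (i, j) = M $$ ((i + 1) mod n, j)"
proof -
  have "(cyclic_shift n * M) $$ (i, j)
      = (\<Sum>k\<in>{0..<n}. (if k = (i + 1) mod n then 1 else 0) * M $$ (k, j))"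
    using assms by (auto simp: scalar_prod_def cyclic_shift_index intro!: sum.cong)
  also have "\<dots> = (\<Sum>k\<in>{0..<n}. if k = (i + 1) mod n then M $$ (k, j) else 0)"
    by (intro sum.cong) auto
  also have "\<dots> = M $$ ((i + 1) mod n, j)"
    using assms by (simp add: sum.delta)
  finally show ?thesis .
qed

lemma Suc_mod_inj:
  fixes j k n :: nat
  assumes "j < n" "k < n"
  shows "(j + 1) mod n = (k + 1) mod n \<longleftrightarrow> j = k"
  using assms by (auto simp: mod_Suc split: if_splits)

lemma cyclic_distance:
  fixes i j n :: nat
  assumes "i < n" "j < n"
  shows "(j + n - i) mod n = (if i \<le> j then j - i else j + n - i)"
proof (cases "i \<le> j")
  case True
  hence "j + n - i = (j - i) + n" by simp
  hence "(j + n - i) mod n = (j - i) mod n" by (metis mod_add_self2)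
  thus ?thesis using True assms by simp
qed (use assms in auto)

lemma mult_cyclic_shift_index:
  assumes "M \<in> carrier_mat m n" "i < m" "j < n"
  shows "(M * cyclic_shift n) $$ (i, (j + 1) mod n) = M $$ (i, j)"
proof -
  have "(M * cyclic_shift n) $$ (i, (j + 1) mod n)
      = (\<Sum>k\<in>{0..<n}. M $$ (i, k) * (if (j + 1) mod n = (k + 1) mod n then 1 else 0))"
    using assms by (auto simp: scalar_prod_def cyclic_shift_index intro!: sum.cong)
  also have "\<dots> = (\<Sum>k\<in>{0..<n}. if k = j then M $$ (i, k) else 0)"
    using assms Suc_mod_inj[of j n] by (intro sum.cong) auto
  also have "\<dots> = M $$ (i, j)"
    using assms by (simp add: sum.delta)
  finally show ?thesis .
qed

lemma cyclic_shift_pow_index: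
  assumes "i < n" "j < n"
  shows "(cyclic_shift n ^\<^sub>m k) $$ (i, j) = (if j = (i + k) mod n then 1 else 0)"
  using assms(2)
proof (induction k arbitrary: j)
  case 0
  thus ?case using assms(1) by auto
next
  case (Suc k)
  \<comment> \<open>every column index is a successor modulo n\<close>
  obtain l where l: "l < n" "j = (l + 1) mod n"
    using Suc.prems by (cases j) (auto intro: that[of "n - 1"] that[of "j - 1"])
  have "cyclic_shift n ^\<^sub>m k \<in> carrier_mat n n" by (intro pow_carrier_mat) auto
  hence "(cyclic_shift n ^\<^sub>m Suc k) $$ (i, j) = (cyclic_shift n ^\<^sub>m k) $$ (i, l)"
    using mult_cyclic_shift_index[of "cyclic_shift n ^\<^sub>m k" n n i l] assms(1) l by simp
  also have "\<dots> = (if l = (i + k) mod n then 1 else 0)"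
    using Suc.IH l by blast
  also have "l = (i + k) mod n \<longleftrightarrow> j = (i + Suc k) mod n"
    using Suc_mod_inj[of l n "(i + k) mod n"] l by (simp add: mod_Suc_eq)
  finally show ?case .
qed

definition shift_invariant :: "nat \<Rightarrow> real mat \<Rightarrow> bool" where
  "shift_invariant n M \<longleftrightarrow> (\<forall>i<n. \<forall>j<n. M $$ ((i + 1) mod n, (j + 1) mod n) = M $$ (i, j))"

lemma shift_invariant_iff_commutes:
  assumes M: "M \<in> carrier_mat n n"
  shows "shift_invariant n M \<longleftrightarrow> cyclic_shift n * M = M * cyclic_shift n"
proof
  assume inv: "shift_invariant n M"
  show "cyclic_shift n * M = M * cyclic_shift n"
  proof (rule eq_matI)
    fix i j assume "i < dim_row (M * cyclic_shift n)" "j < dim_col (M * cyclic_shift n)"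
    hence ij: "i < n" "j < n" using M by auto
    obtain l where l: "l < n" "j = (l + 1) mod n"
      using ij by (cases j) (auto intro: that[of "n - 1"] that[of "j - 1"])
    show "(cyclic_shift n * M) $$ (i, j) = (M * cyclic_shift n) $$ (i, j)"
      using cyclic_shift_mult_index[OF M ij] mult_cyclic_shift_index[OF M ij(1) l(1)] inv ij l
      by (simp add: shift_invariant_def)
  qed (use M in auto)
next
  assume comm: "cyclic_shift n * M = M * cyclic_shift n"
  show "shift_invariant n M"
    unfolding shift_invariant_def
  proof (intro allI impI)
    fix i j assume ij: "i < n" "j < n"
    hence "(j + 1) mod n < n" by auto
    from cyclic_shift_mult_index[OF M ij(1) this] mult_cyclic_shift_index[OF M ij] comm
    show "M $$ ((i + 1) mod n, (j + 1) mod n) = M $$ (i, j)" by simp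
  qed
qed

lemma shift_invariant_index:
  assumes "shift_invariant n M" "i < n" "j < n"
  shows "M $$ (i, j) = M $$ (0, (j + n - i) mod n)"
  using assms(2,3)
proof (induction i arbitrary: j)
  case 0
  thus ?case by simp
next
  case (Suc i)
  obtain l where l: "l < n" "j = (l + 1) mod n"
    using Suc.prems by (cases j) (auto intro: that[of "n - 1"] that[of "j - 1"])
  have "M $$ (Suc i, j) = M $$ ((i + 1) mod n, (l + 1) mod n)"
    using Suc.prems l by simp
  also have "\<dots> = M $$ (i, l)"
    using assms(1) Suc.prems(1) l(1) unfolding shift_invariant_def by (metis Suc_lessD)
  also have "\<dots> = M $$ (0, (l + n - i) mod n)"
    using Suc l by simp
  also have "(l + n - i) mod n = (j + n - Suc i) mod n"
  proof (cases "l + 1 = n")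
    case True
    hence "j = 0" "l + n - i = (n - Suc i) + n" using l Suc.prems by auto
    thus ?thesis by (metis add_0 mod_add_self2)
  next
    case False
    thus ?thesis using l by simp
  qed
  finally show ?case .
qed

text \<open>
  The shift \<open>S\<close> commutes with \<open>A\<close>, hence \<open>S C = (C A) S C = C S (A C) = C S\<close>.
\<close>

lemma shift_invariant_inverse:
  assumes A: "A \<in> carrier_mat n n" and C: "C \<in> carrier_mat n n"
    and inv: "A * C = 1\<^sub>m n" "C * A = 1\<^sub>m n" and "shift_invariant n A"
  shows "shift_invariant n C"
proof -
  let ?S = "cyclic_shift n"
  have S: "?S \<in> carrier_mat n n" by simp
  have comm: "?S * A = A * ?S"
    using assms shift_invariant_iff_commutes by blast
  have "?S * C = (C * A) * (?S * C)" using inv S C by simp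
  also have "\<dots> = C * (A * (?S * C))"
    by (rule assoc_mult_mat[OF C A]) (use S C in auto)
  also have "A * (?S * C) = (A * ?S) * C"
    by (rule assoc_mult_mat[symmetric, OF A S C])
  also have "\<dots> = ?S * (A * C)"
    unfolding comm[symmetric] by (rule assoc_mult_mat[OF S A C])
  also have "\<dots> = ?S" using inv S by simp
  finally show ?thesis using shift_invariant_iff_commutes[OF C] by simp
qed

lemma finsum_mat_carrier:
  fixes f :: "'i \<Rightarrow> real mat"
  assumes "\<And>k. k \<in> F \<Longrightarrow> f k \<in> carrier_mat n n"
  shows "finsum (ring_mat TYPE(real) n ()) f F \<in> carrier_mat n n"
proof -
  interpret R: ring "ring_mat TYPE(real) n ()" by (rule ring_mat)
  show ?thesis using R.finsum_closed[of f F] assms by (auto simp: ring_mat_simps)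
qed

lemma index_finsum_mat:
  fixes f :: "'i \<Rightarrow> real mat"
  assumes "finite F" "\<And>k. k \<in> F \<Longrightarrow> f k \<in> carrier_mat n n" "i < n" "j < n"
  shows "finsum (ring_mat TYPE(real) n ()) f F $$ (i, j) = (\<Sum>k\<in>F. f k $$ (i, j))"
  using assms(1,2)
proof (induction F)
  case empty
  interpret R: ring "ring_mat TYPE(real) n ()" by (rule ring_mat)
  show ?case using assms(3,4) by (simp add: ring_mat_simps)
next
  case (insert x F)
  interpret R: ring "ring_mat TYPE(real) n ()" by (rule ring_mat)
  have "finsum (ring_mat TYPE(real) n ()) f (insert x F)
       = f x + finsum (ring_mat TYPE(real) n ()) f F"
    using insert by (subst R.finsum_insert) (auto simp: ring_mat_simps)
  thus ?case using insert assms(3,4) finsum_mat_carrier[of F f n] by simp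
qed

lemma shift_polynomial_index:
  fixes \<alpha> :: "nat \<Rightarrow> real" and n :: nat
  defines "A \<equiv> finsum (ring_mat TYPE(real) n ()) (\<lambda>k. \<alpha> k \<cdot>\<^sub>m (cyclic_shift n ^\<^sub>m (k - 1))) {1..n}"
  assumes "n > 0"
  shows "A \<in> carrier_mat n n"
    and "\<And>i j. i < n \<Longrightarrow> j < n \<Longrightarrow> A $$ (i, j) = \<alpha> ((j + n - i) mod n + 1)"
proof -
  have car: "\<alpha> k \<cdot>\<^sub>m (cyclic_shift n ^\<^sub>m (k - 1)) \<in> carrier_mat n n" for k
    by (intro smult_carrier_mat pow_carrier_mat) simp
  show "A \<in> carrier_mat n n"
    unfolding A_def by (rule finsum_mat_carrier) (rule car)
  fix i j assume ij: "i < n" "j < n"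
  \<comment> \<open>the power of the shift that reaches column j from row i\<close>
  let ?d = "(j + n - i) mod n"
  have d: "?d < n" using ij by simp
  have reach: "j = (i + k) mod n \<longleftrightarrow> k = ?d" if "k < n" for k
  proof -
    have "?d = (if i \<le> j then j - i else j + n - i)"
      using ij by (rule cyclic_distance)
    moreover have "(i + k) mod n = (if i + k < n then i + k else i + k - n)"
      using ij that by (simp add: mod_if)
    ultimately show ?thesis using ij that by auto
  qed
  have "A $$ (i, j) = (\<Sum>k\<in>{1..n}. (\<alpha> k \<cdot>\<^sub>m (cyclic_shift n ^\<^sub>m (k - 1))) $$ (i, j))"
    unfolding A_def by (rule index_finsum_mat[OF _ car ij]) simp
  also have "\<dots> = (\<Sum>k\<in>{1..n}. if k = ?d + 1 then \<alpha> k else 0)"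
  proof (intro sum.cong refl)
    fix k assume k: "k \<in> {1..n}"
    have "(\<alpha> k \<cdot>\<^sub>m (cyclic_shift n ^\<^sub>m (k - 1))) $$ (i, j)
        = \<alpha> k * (cyclic_shift n ^\<^sub>m (k - 1)) $$ (i, j)"
      using ij pow_carrier_mat[of "cyclic_shift n" n "k - 1"] by (subst index_smult_mat) auto
    also have "\<dots> = \<alpha> k * (if k - 1 = ?d then 1 else 0)"
    proof -
      have "k - 1 < n" using k by auto
      thus ?thesis unfolding cyclic_shift_pow_index[OF ij] by (simp only: reach)
    qed
    also have "\<dots> = (if k = ?d + 1 then \<alpha> k else 0)" using k by auto
    finally show "(\<alpha> k \<cdot>\<^sub>m (cyclic_shift n ^\<^sub>m (k - 1))) $$ (i, j)
        = (if k = ?d + 1 then \<alpha> k else 0)" .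
  qed
  also have "\<dots> = \<alpha> (?d + 1)" using d by (simp add: sum.delta)
  finally show "A $$ (i, j) = \<alpha> (?d + 1)" .
qed

lemma shift_invariantI_index:
  assumes "\<And>i j. i < n \<Longrightarrow> j < n \<Longrightarrow> M $$ (i, j) = c ((j + n - i) mod n)"
  shows "shift_invariant n M"
  unfolding shift_invariant_def
proof (intro allI impI)
  fix i j assume ij: "i < n" "j < n"
  have "((j + 1) mod n + n - (i + 1) mod n) mod n = (j + n - i) mod n"
    using ij by (auto simp: mod_Suc mod_if)
  thus "M $$ ((i + 1) mod n, (j + 1) mod n) = M $$ (i, j)"
    using assms[of "(i + 1) mod n" "(j + 1) mod n"] assms[OF ij] ij by simp
qed

section \<open>The pencil of the identity and the shift\<close>

definition shift_pencil :: "nat \<Rightarrow> real \<Rightarrow> real \<Rightarrow> real mat" where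
  "shift_pencil n a b = a \<cdot>\<^sub>m 1\<^sub>m n + b \<cdot>\<^sub>m cyclic_shift n"

lemma shift_pencil_carrier [simp]:
  "shift_pencil n a b \<in> carrier_mat n n"
  "dim_row (shift_pencil n a b) = n" "dim_col (shift_pencil n a b) = n"
  by (auto simp: shift_pencil_def)

lemma shift_pencil_index:
  assumes "n \<ge> 2" "i < n" "j < n"
  shows "shift_pencil n a b $$ (i, j) = (if j = i then a else if j = (i + 1) mod n then b else 0)"
  using assms by (auto simp: shift_pencil_def cyclic_shift_index mod_Suc split: if_splits)

lemma shift_pencil_mult_index:
  assumes "M \<in> carrier_mat n n" "i < n" "j < n"
  shows "(shift_pencil n a b * M) $$ (i, j) = a * M $$ (i, j) + b * M $$ ((i + 1) mod n, j)"
proof -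
  have "shift_pencil n a b * M = a \<cdot>\<^sub>m M + b \<cdot>\<^sub>m (cyclic_shift n * M)"
    unfolding shift_pencil_def using assms(1)
    by (subst add_mult_distrib_mat[of _ n n]) (auto simp: mult_smult_assoc_mat[of _ n n])
  thus ?thesis
    using assms cyclic_shift_mult_index[OF assms] by auto
qed

text \<open>
  The first row of \<open>C\<close> is supported on its first two columns, the loop and the arc at \<open>v\<^sub>1\<close>, and
  shift invariance copies it to the other rows.
\<close>

lemma shift_invariant_cycle_eq_pencil:
  assumes n: "n \<ge> 2" and C: "C \<in> carrier_mat n n" and inv: "shift_invariant n C"
    and graph: "digraph_of_mat n C = cycle_with_loops n"
  shows "C = shift_pencil n (C $$ (0, 0)) (C $$ (0, 1))"
proof (rule eq_matI)
  fix i j assume "i < dim_row (shift_pencil n (C $$ (0, 0)) (C $$ (0, 1)))"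
    "j < dim_col (shift_pencil n (C $$ (0, 0)) (C $$ (0, 1)))"
  hence ij: "i < n" "j < n" by auto
  let ?d = "(j + n - i) mod n"
  have zero: "C $$ (0, d) = 0" if "2 \<le> d" "d < n" for d
  proof -
    have "(0, d) \<notin> parcs (digraph_of_mat n C)"
      unfolding graph using that by (auto simp: cycle_with_loops_def)
    thus ?thesis using that by (simp add: digraph_of_mat_def)
  qed
  have d: "?d = (if i \<le> j then j - i else j + n - i)"
    using ij by (rule cyclic_distance)
  have "j = i \<longleftrightarrow> ?d = 0" "j = (i + 1) mod n \<longleftrightarrow> ?d = 1"
    unfolding d using ij n by (auto simp: mod_Suc)
  moreover have "?d < n" using ij by simp
  ultimately show "C $$ (i, j) = shift_pencil n (C $$ (0, 0)) (C $$ (0, 1)) $$ (i, j)"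
    using shift_invariant_index[OF inv ij] zero[of ?d] shift_pencil_index[OF n ij] by auto
qed (use C in auto)

lemma digraph_shift_pencil:
  assumes n: "n \<ge> 2" and ab: "a \<noteq> 0" "b \<noteq> 0"
  shows "digraph_of_mat n (shift_pencil n a b) = cycle_with_loops n"
proof -
  have "(i < n \<and> j < n \<and> shift_pencil n a b $$ (i, j) \<noteq> 0) \<longleftrightarrow>
      (j = i + 1 \<and> i + 1 < n \<or> i = n - 1 \<and> j = 0 \<or> j = i \<and> i < n)" for i j
  proof (cases "i < n \<and> j < n")
    case True
    hence "shift_pencil n a b $$ (i, j) \<noteq> 0 \<longleftrightarrow> j = i \<or> j = (i + 1) mod n"
      using shift_pencil_index[OF n, of i j a b] ab by simp
    moreover have "j = (i + 1) mod n \<longleftrightarrow> j = i + 1 \<or> i = n - 1 \<and> j = 0"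
      using True by (cases "i + 1 = n") auto
    ultimately show ?thesis using True by auto
  next
    case False
    thus ?thesis using n by auto
  qed
  hence "{(i, j). i < n \<and> j < n \<and> shift_pencil n a b $$ (i, j) \<noteq> 0}
      = {(i, j). j = i + 1 \<and> i + 1 < n \<or> i = n - 1 \<and> j = 0 \<or> j = i \<and> i < n}"
    by presburger
  also have "\<dots> = {(i, i + 1) | i. i + 1 < n} \<union> {(n - 1, 0)} \<union> {(i, i) | i. i < n}"
    by auto
  finally show ?thesis by (simp add: digraph_of_mat_def cycle_with_loops_def)
qed

section \<open>Spectral radii\<close>

abbreviation cmat :: "real mat \<Rightarrow> complex mat" where
  "cmat \<equiv> map_mat complex_of_real"

lemma mult_vec_cmat_index:
  assumes "B \<in> carrier_mat n n" "v \<in> carrier_vec n" "i < n"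
  shows "(cmat B *\<^sub>v v) $ i = (\<Sum>j<n. complex_of_real (B $$ (i, j)) * v $ j)"
  using assms by (auto simp: scalar_prod_def atLeast0LessThan intro!: sum.cong)

lemma rho_obtains_eigenvector:
  assumes B: "B \<in> carrier_mat n n" and n: "n > 0"
  obtains k v where "rho B = cmod k" "\<exists>i<n. v $ i \<noteq> 0"
    "\<And>i. i < n \<Longrightarrow> (\<Sum>j<n. complex_of_real (B $$ (i, j)) * v $ j) = k * v $ i"
proof -
  have cB: "cmat B \<in> carrier_mat n n" using B by simp
  obtain k where k: "k \<in> spectrum (cmat B)" "rho B = cmod k"
    using spectral_radius_mem_max(1)[OF cB n] unfolding rho_def by auto
  then obtain v where v: "v \<in> carrier_vec n" "v \<noteq> 0\<^sub>v n" "cmat B *\<^sub>v v = k \<cdot>\<^sub>v v"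
    using B unfolding spectrum_def eigenvalue_def eigenvector_def by auto
  have "\<exists>i<n. v $ i \<noteq> 0"
    using v(1,2) by (metis carrier_vecD eq_vecI index_zero_vec)
  moreover have "(\<Sum>j<n. complex_of_real (B $$ (i, j)) * v $ j) = k * v $ i" if "i < n" for i
    using mult_vec_cmat_index[OF B v(1) that] v that by simp
  ultimately show ?thesis using that k v by blast
qed

lemma abs_real_eigenvalue_le_rho:
  assumes B: "B \<in> carrier_mat n n" and p: "p < n" "v p \<noteq> 0"
    and eig: "\<And>i. i < n \<Longrightarrow> (\<Sum>j<n. B $$ (i, j) * v j) = l * v i"
  shows "\<bar>l\<bar> \<le> rho B"
proof -
  have cB: "cmat B \<in> carrier_mat n n" using B by simp
  define w where "w = vec n (\<lambda>i. complex_of_real (v i))"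
  have w: "w \<in> carrier_vec n" "w $ p \<noteq> 0" using p by (auto simp: w_def)
  hence "w \<noteq> 0\<^sub>v n" using p by auto
  moreover have "cmat B *\<^sub>v w = complex_of_real l \<cdot>\<^sub>v w"
  proof (rule eq_vecI)
    fix i assume "i < dim_vec (complex_of_real l \<cdot>\<^sub>v w)"
    hence i: "i < n" by (simp add: w_def)
    have "(cmat B *\<^sub>v w) $ i = complex_of_real (\<Sum>j<n. B $$ (i, j) * v j)"
      unfolding mult_vec_cmat_index[OF B w(1) i] by (simp add: w_def)
    thus "(cmat B *\<^sub>v w) $ i = (complex_of_real l \<cdot>\<^sub>v w) $ i"
      using i eig by (simp add: w_def)
  qed (use B in \<open>auto simp: w_def\<close>)
  ultimately have "complex_of_real l \<in> spectrum (cmat B)"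
    using w B unfolding spectrum_def eigenvalue_def eigenvector_def by auto
  hence "cmod (complex_of_real l) \<le> rho B"
    unfolding rho_def using spectral_radius_mem_max(2)[OF cB] p by blast
  thus ?thesis by simp
qed

text \<open>
  The eigenvalue equation in the row where an eigenvector is largest in modulus bounds the
  eigenvalue by the sum of that row.
\<close>

lemma rho_le_row_sum:
  assumes B: "B \<in> carrier_mat n n" and n: "n > 0"
    and row: "\<And>i. i < n \<Longrightarrow> (\<Sum>j<n. \<bar>B $$ (i, j)\<bar>) \<le> r"
  shows "rho B \<le> r"
proof -
  obtain k v where kv: "rho B = cmod k" "\<exists>i<n. v $ i \<noteq> 0"
    "\<And>i. i < n \<Longrightarrow> (\<Sum>j<n. complex_of_real (B $$ (i, j)) * v $ j) = k * v $ i"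
    by (rule rho_obtains_eigenvector[OF B n]) (rule that)
  have "Max ((\<lambda>i. cmod (v $ i)) ` {..<n}) \<in> (\<lambda>i. cmod (v $ i)) ` {..<n}"
    using n by (intro Max_in) auto
  then obtain m where m: "m < n" "cmod (v $ m) = Max ((\<lambda>i. cmod (v $ i)) ` {..<n})"
    by auto
  have le: "cmod (v $ i) \<le> cmod (v $ m)" if "i < n" for i
    unfolding m(2) using that by (intro Max_ge) auto
  have "cmod k * cmod (v $ m) = cmod (\<Sum>j<n. complex_of_real (B $$ (m, j)) * v $ j)"
    using kv(3)[OF m(1)] by (simp add: norm_mult)
  also have "\<dots> \<le> (\<Sum>j<n. \<bar>B $$ (m, j)\<bar> * cmod (v $ m))"
    by (intro sum_norm_le) (auto simp: norm_mult intro!: mult_left_mono le)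
  also have "\<dots> = (\<Sum>j<n. \<bar>B $$ (m, j)\<bar>) * cmod (v $ m)"
    by (simp add: sum_distrib_right)
  also have "\<dots> \<le> r * cmod (v $ m)"
    using row[OF m(1)] by (intro mult_right_mono) auto
  finally have "cmod k * cmod (v $ m) \<le> r * cmod (v $ m)" .
  moreover have "cmod (v $ m) > 0"
    using kv(2) le by (metis less_le_trans zero_less_norm_iff)
  ultimately show ?thesis using kv(1) by simp
qed

lemma shift_pencil_row_sum:
  fixes v :: "nat \<Rightarrow> real"
  assumes "n \<ge> 2" "i < n"
  shows "(\<Sum>j<n. shift_pencil n s c $$ (i, j) * v j) = s * v i + c * v ((i + 1) mod n)"
proof -
  have ne: "(i + 1) mod n \<noteq> i" using assms by (auto simp: mod_Suc split: if_splits)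
  have "(\<Sum>j<n. shift_pencil n s c $$ (i, j) * v j)
      = (\<Sum>j<n. (if j = i then s * v j else 0) + (if j = (i + 1) mod n then c * v j else 0))"
    using assms ne by (intro sum.cong) (auto simp: shift_pencil_index)
  thus ?thesis using assms by (simp add: sum.distrib)
qed

lemma rho_shift_pencil:
  assumes n: "n \<ge> 2" and "s \<ge> 0" "c \<ge> 0"
  shows "rho (shift_pencil n s c) = s + c"
proof (rule antisym)
  have "(\<Sum>j<n. \<bar>shift_pencil n s c $$ (i, j)\<bar>) = s + c" if "i < n" for i
  proof -
    have "\<bar>shift_pencil n s c $$ (i, j)\<bar> = shift_pencil n s c $$ (i, j) * 1" if "j < n" for j
      using that \<open>i < n\<close> assms by (simp add: shift_pencil_index)
    thus ?thesis
      using shift_pencil_row_sum[OF n that, of s c "\<lambda>_. 1"] by simp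
  qed
  thus "rho (shift_pencil n s c) \<le> s + c"
    using n by (intro rho_le_row_sum) auto
  have "\<bar>s + c\<bar> \<le> rho (shift_pencil n s c)"
  proof (rule abs_real_eigenvalue_le_rho[where p = 0 and v = "\<lambda>_. 1"])
    show "(\<Sum>j<n. shift_pencil n s c $$ (i, j) * 1) = (s + c) * 1" if "i < n" for i
      using shift_pencil_row_sum[OF n that, of s c "\<lambda>_. 1"] by simp
  qed (use n in auto)
  thus "s + c \<le> rho (shift_pencil n s c)" by simp
qed

lemma Suc_mod_closed_eq:
  fixes S :: "nat set"
  assumes "S \<subseteq> {0..<n}" "S \<noteq> {}" and step: "\<And>p. p \<in> S \<Longrightarrow> (p + 1) mod n \<in> S"
  shows "S = {0..<n}"
proof -
  obtain p where p: "p \<in> S" "p < n" using assms by fastforce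
  have walk: "(p + k) mod n \<in> S" for k
  proof (induction k)
    case 0
    thus ?case using p by simp
  next
    case (Suc k)
    thus ?case using step[OF Suc] by (simp add: mod_Suc_eq)
  qed
  have "x \<in> S" if "x < n" for x
    using walk[of "n + x - p"] p that by simp
  thus ?thesis using assms by auto
qed

text \<open>
  If \<open>k \<noteq> s\<close> were an eigenvalue of a proper principal submatrix, the eigenvalue equation in a row
  where the eigenvector does not vanish would require the successor of that row to be present with a
  nonzero component as well. Going around the cycle, no index could have been deleted. Thus \<open>s\<close> is
  the only eigenvalue; this is the acyclicity of the digraph left after deleting a vertex.
\<close>

lemma rho_proper_principal_submatrix:
  assumes n: "n \<ge> 2" and I: "I \<subset> {0..<n}" "I \<noteq> {}"
  shows "rho (submatrix (shift_pencil n s c) I I) = \<bar>s\<bar>"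
proof -
  let ?P = "shift_pencil n s c"
  let ?B = "submatrix ?P I I"
  define m where "m = card I"
  have I_eq: "{i. i < n \<and> i \<in> I} = I" using I by auto
  have finI: "finite I" using I finite_subset by blast
  have m: "m > 0" using I finI by (simp add: m_def card_gt_0_iff)
  have B: "?B \<in> carrier_mat m m"
    by (auto simp: dim_submatrix I_eq m_def)
  have B_index: "?B $$ (i, j) = ?P $$ (pick I i, pick I j)" if "i < m" "j < m" for i j
    using that by (intro submatrix_index) (auto simp: I_eq m_def)
  have pick_I: "pick I i \<in> I" if "i < m" for i
    using that by (intro pick_in_set_le) (simp add: m_def)
  hence pick_n: "pick I i < n" if "i < m" for i using I that by fastforce
  have pick_inj: "i = j" if "pick I i = pick I j" "i < m" "j < m" for i j
    using that card_pick_le[of _ I] by (metis m_def)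
  obtain k v where kv: "rho ?B = cmod k" "\<exists>i<m. v $ i \<noteq> 0"
    "\<And>i. i < m \<Longrightarrow> (\<Sum>j<m. complex_of_real (?B $$ (i, j)) * v $ j) = k * v $ i"
    by (rule rho_obtains_eigenvector[OF B m]) (rule that)
  have "k = complex_of_real s"
  proof (rule ccontr)
    assume k: "k \<noteq> complex_of_real s"
    define S where "S = {pick I i | i. i < m \<and> v $ i \<noteq> 0}"
    have "S = {0..<n}"
    proof (rule Suc_mod_closed_eq)
      show "S \<subseteq> {0..<n}" using pick_n by (auto simp: S_def)
      show "S \<noteq> {}" using kv(2) by (auto simp: S_def)
    next
      fix p assume "p \<in> S"
      then obtain i where i: "i < m" "v $ i \<noteq> 0" "p = pick I i" by (auto simp: S_def)
      have diag: "?B $$ (i, i) = s"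
        using B_index[OF i(1) i(1)] shift_pencil_index[OF n] pick_n[OF i(1)] by simp
      have "(\<Sum>j<m. complex_of_real (?B $$ (i, j)) * v $ j)
          = complex_of_real s * v $ i + (\<Sum>j\<in>{..<m} - {i}. complex_of_real (?B $$ (i, j)) * v $ j)"
        using i(1) diag by (subst sum.remove[of _ i]) auto
      hence "(\<Sum>j\<in>{..<m} - {i}. complex_of_real (?B $$ (i, j)) * v $ j)
          = (k - complex_of_real s) * v $ i"
        using kv(3)[OF i(1)] by (simp add: algebra_simps)
      hence "(\<Sum>j\<in>{..<m} - {i}. complex_of_real (?B $$ (i, j)) * v $ j) \<noteq> 0"
        using k i(2) by simp
      then obtain j where j: "j \<in> {..<m} - {i}" "complex_of_real (?B $$ (i, j)) * v $ j \<noteq> 0"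
        by (rule sum.not_neutral_contains_not_neutral)
      hence "pick I j \<noteq> pick I i" using pick_inj i(1) by auto
      moreover have "?P $$ (pick I i, pick I j) \<noteq> 0"
        using j B_index[OF i(1)] by auto
      ultimately have "pick I j = (p + 1) mod n"
        using shift_pencil_index[OF n pick_n[OF i(1)], of "pick I j" s c] pick_n[of j] j i(3)
        by (auto split: if_splits)
      thus "(p + 1) mod n \<in> S"
        using j unfolding S_def mem_Collect_eq by (intro exI[of _ j]) auto
    qed
    moreover have "S \<subseteq> I" using pick_I by (auto simp: S_def)
    ultimately show False using I by auto
  qed
  thus ?thesis using kv(1) by simp
qed

lemma rho_principal_shift_pencil:
  assumes n: "n \<ge> 2"
  shows "rho_principal (n - 1) (shift_pencil n s c) = \<bar>s\<bar>"
proof -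
  let ?Is = "{I. I \<subseteq> {0..<n} \<and> card I = n - 1}"
  have "rho (submatrix (shift_pencil n s c) I I) = \<bar>s\<bar>" if "I \<in> ?Is" for I
    using that n by (intro rho_proper_principal_submatrix) auto
  hence "(\<lambda>I. rho (submatrix (shift_pencil n s c) I I)) ` ?Is = (\<lambda>_. \<bar>s\<bar>) ` ?Is"
    by (rule image_cong[OF refl])
  also have "\<dots> = {\<bar>s\<bar>}"
    by (rule image_constant[of "{0..<n - 1}"]) auto
  finally show ?thesis by (simp add: rho_principal_def setcompr_eq_image)
qed

lemma nonneg_shift_pencil_iff:
  assumes "n \<ge> 2"
  shows "nonneg_mat (shift_pencil n s c) \<longleftrightarrow> s \<ge> 0 \<and> c \<ge> 0"
proof
  assume nn: "nonneg_mat (shift_pencil n s c)"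
  have "shift_pencil n s c $$ (i, j) \<ge> 0" if "i < n" "j < n" for i j
    using nn that unfolding nonneg_mat_def by (meson elements_matI shift_pencil_carrier(1))
  from this[of 0 0] this[of 0 1] show "s \<ge> 0 \<and> c \<ge> 0"
    using assms by (simp add: shift_pencil_index)
next
  assume "s \<ge> 0 \<and> c \<ge> 0"
  thus "nonneg_mat (shift_pencil n s c)"
    unfolding nonneg_mat_def using assms by (auto dest!: elements_matD simp: shift_pencil_index)
qed

lemma scalar_minus_shift_pencil:
  "t \<cdot>\<^sub>m 1\<^sub>m n - shift_pencil n a b = shift_pencil n (t - a) (- b)"
  by (rule eq_matI) (auto simp: shift_pencil_def)

text \<open>
  A splitting \<open>a I + b Z = t I - B\<close> forces \<open>B = (t - a) I - b Z\<close>, and the spectral radii of this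
  matrix turn \<open>\<rho>\<^sub>n\<^sub>-\<^sub>1(B) < t < \<rho>(B)\<close> into \<open>t - a < t < t - a - b\<close>.
\<close>

lemma N_matrix_shift_pencil_iff:
  assumes n: "n \<ge> 2"
  shows "N_matrix n (shift_pencil n a b) \<longleftrightarrow> 0 < a \<and> a < - b"
proof
  assume "N_matrix n (shift_pencil n a b)"
  then obtain t B where B: "B \<in> carrier_mat n n" "nonneg_mat B"
    "shift_pencil n a b = t \<cdot>\<^sub>m 1\<^sub>m n - B"
    and t: "rho_principal (n - 1) B < t" "t < rho B"
    unfolding N_matrix_def by blast
  have "B = t \<cdot>\<^sub>m 1\<^sub>m n - shift_pencil n a b"
    unfolding B(3) using B(1) by (intro eq_matI) auto
  hence B_eq: "B = shift_pencil n (t - a) (- b)" by (simp add: scalar_minus_shift_pencil)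
  hence "t - a \<ge> 0" "- b \<ge> 0" using B(2) nonneg_shift_pencil_iff[OF n] by blast+
  thus "0 < a \<and> a < - b"
    using t rho_principal_shift_pencil[OF n] rho_shift_pencil[OF n] unfolding B_eq by simp
next
  assume ab: "0 < a \<and> a < - b"
  \<comment> \<open>the splitting with t = a, in which B has zero diagonal\<close>
  let ?B = "shift_pencil n 0 (- b)"
  have "shift_pencil n a b = a \<cdot>\<^sub>m 1\<^sub>m n - ?B" by (simp add: scalar_minus_shift_pencil)
  moreover have "nonneg_mat ?B" using nonneg_shift_pencil_iff[OF n] ab by simp
  moreover have "rho_principal (n - 1) ?B < a" "a < rho ?B"
    using rho_principal_shift_pencil[OF n] rho_shift_pencil[OF n] ab by auto
  moreover have "Z_matrix n (shift_pencil n a b)"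
    unfolding Z_matrix_def using n ab by (auto simp: shift_pencil_index)
  ultimately show "N_matrix n (shift_pencil n a b)"
    unfolding N_matrix_def using n shift_pencil_carrier(1) by blast
qed

section \<open>Inverting the pencil\<close>

lemma shift_pencil_mult_circulant_eq_one_iff:
  assumes n: "n \<ge> 2" and M: "M \<in> carrier_mat n n"
    and M_index: "\<And>i j. i < n \<Longrightarrow> j < n \<Longrightarrow> M $$ (i, j) = c ((j + n - i) mod n)"
  shows "shift_pencil n a b * M = 1\<^sub>m n \<longleftrightarrow>
    a * c 0 + b * c (n - 1) = 1 \<and> (\<forall>d<n - 1. a * c (d + 1) + b * c d = 0)"
proof -
  \<comment> \<open>the entry of the product depends only on the distance of the column from the row\<close>
  let ?e = "\<lambda>d. if d = 0 then a * c 0 + b * c (n - 1) else a * c d + b * c (d - 1)"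
  have entry: "(shift_pencil n a b * M) $$ (i, j) = ?e ((j + n - i) mod n)"
    if ij: "i < n" "j < n" for i j
  proof -
    let ?d = "(j + n - i) mod n"
    have next_lt: "(i + 1) mod n < n" using n by simp
    have succ: "(i + 1) mod n = (if i + 1 = n then 0 else i + 1)" using ij by auto
    have "(j + n - (i + 1) mod n) mod n = (if ?d = 0 then n - 1 else ?d - 1)"
      unfolding cyclic_distance[OF ij] cyclic_distance[OF next_lt ij(2)]
      unfolding succ using ij by auto
    hence next_row: "M $$ ((i + 1) mod n, j) = c (if ?d = 0 then n - 1 else ?d - 1)"
      using M_index[OF next_lt ij(2)] by simp
    have "(shift_pencil n a b * M) $$ (i, j) = a * c ?d + b * c (if ?d = 0 then n - 1 else ?d - 1)"
      unfolding shift_pencil_mult_index[OF M ij] next_row M_index[OF ij] ..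
    thus ?thesis by (cases "?d = 0") simp_all
  qed
  have one: "1\<^sub>m n $$ (i, j) = (if (j + n - i) mod n = 0 then 1 else 0 :: real)"
    if "i < n" "j < n" for i j
    using that by (simp add: cyclic_distance)
  have "shift_pencil n a b * M = 1\<^sub>m n \<longleftrightarrow> (\<forall>d<n. ?e d = (if d = 0 then 1 else 0))"
  proof
    assume eq: "shift_pencil n a b * M = 1\<^sub>m n"
    show "\<forall>d<n. ?e d = (if d = 0 then 1 else 0)"
    proof (intro allI impI)
      fix d assume "d < n"
      thus "?e d = (if d = 0 then 1 else 0)" using entry[of 0 d] one[of 0 d] eq by simp
    qed
  next
    assume e: "\<forall>d<n. ?e d = (if d = 0 then 1 else 0)"
    show "shift_pencil n a b * M = 1\<^sub>m n"
    proof (rule eq_matI)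
      fix i j assume "i < dim_row (1\<^sub>m n :: real mat)" "j < dim_col (1\<^sub>m n :: real mat)"
      hence ij: "i < n" "j < n" by auto
      hence "(j + n - i) mod n < n" by simp
      thus "(shift_pencil n a b * M) $$ (i, j) = 1\<^sub>m n $$ (i, j)"
        using entry[OF ij] one[OF ij] e by metis
    qed (use M in auto)
  qed
  also have "\<dots> \<longleftrightarrow> a * c 0 + b * c (n - 1) = 1 \<and> (\<forall>d<n - 1. a * c (d + 1) + b * c d = 0)"
  proof -
    obtain m where m: "n = Suc m" using n by (cases n) auto
    show ?thesis unfolding m by (simp add: All_less_Suc2)
  qed
  finally show ?thesis .
qed

lemma geometric_if_ratio:
  fixes c :: "nat \<Rightarrow> 'a :: comm_monoid_mult"
  assumes "\<And>d. d < m \<Longrightarrow> c (d + 1) = q * c d" "d \<le> m"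
  shows "c d = c 0 * q ^ d"
  using assms(2)
proof (induction d)
  case (Suc d)
  thus ?case using assms(1)[of d] by (simp add: ac_simps)
qed simp

text \<open>
  The recurrence says that \<open>c\<close> is geometric with ratio \<open>q = - b / a\<close>, the closing equation that
  \<open>a * c 0 * (1 - q ^ n) = 1\<close>. The inequalities match because \<open>q > 1\<close> makes \<open>1 - q ^ n\<close> negative.
\<close>

lemma pencil_equations_solvable_iff:
  fixes c :: "nat \<Rightarrow> real"
  assumes n: "n \<ge> 2"
  shows "(\<exists>a b. 0 < a \<and> a < - b \<and> a * c 0 + b * c (n - 1) = 1 \<and>
            (\<forall>d<n - 1. a * c (d + 1) + b * c d = 0)) \<longleftrightarrow>
         c 1 < c 0 \<and> c 0 < 0 \<and> (\<forall>d<n. c d = c 0 * (c 1 / c 0) ^ d)"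
    (is "?L \<longleftrightarrow> ?R")
proof
  assume ?L
  then obtain a b where ab: "0 < a" "a < - b" and one: "a * c 0 + b * c (n - 1) = 1"
    and rec: "\<And>d. d < n - 1 \<Longrightarrow> a * c (d + 1) + b * c d = 0"
    by blast
  define q where "q = - b / a"
  have q: "q > 1" "b = - q * a" using ab by (auto simp: q_def divide_less_eq)
  have step: "c (d + 1) = q * c d" if "d < n - 1" for d
  proof -
    have "a * c (d + 1) = a * (q * c d)" using rec[OF that] q(2) by (simp add: algebra_simps)
    thus ?thesis using ab(1) by simp
  qed
  have geo: "c d = c 0 * q ^ d" if "d \<le> n - 1" for d
    using step that by (intro geometric_if_ratio[where c = c and m = "n - 1"]) auto
  have "q * q ^ (n - 1) = q ^ n" using n by (simp flip: power_Suc)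
  hence "a * (c 0 * (q ^ n - 1)) = - 1"
    using one geo[of "n - 1"] q(2) by (simp add: algebra_simps)
  moreover have qn: "q ^ n > 1" using q(1) n by (intro one_less_power) auto
  ultimately have c0: "c 0 < 0"
    using ab(1) by (smt (verit) mult_nonneg_nonneg)
  have c1: "c 1 = q * c 0" using step[of 0] n by simp
  hence ratio: "c 1 / c 0 = q" using c0 by simp
  have "\<forall>d<n. c d = c 0 * (c 1 / c 0) ^ d"
    unfolding ratio
  proof (intro allI impI)
    fix d assume "d < n"
    thus "c d = c 0 * q ^ d" by (intro geo) simp
  qed
  moreover have "c 1 < c 0" using c1 c0 q(1) by (simp add: mult_less_cancel_right1)
  ultimately show ?R using c0 by blast
next
  assume R: ?R
  define q where "q = c 1 / c 0"
  have c0: "c 0 < 0" and c1: "c 1 < c 0" and geo: "\<And>d. d < n \<Longrightarrow> c d = c 0 * q ^ d"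
    unfolding q_def using R by blast+
  have q: "q > 1" using c0 c1 by (simp add: q_def less_divide_eq)
  hence qn: "q ^ n > 1" using n by (intro one_less_power) auto
  define a where "a = 1 / (c 0 * (1 - q ^ n))"
  have ne: "c 0 * (1 - q ^ n) \<noteq> 0" using c0 qn by simp
  have a: "a > 0" unfolding a_def using c0 qn by (intro divide_pos_pos mult_neg_neg) auto
  have "q * q ^ (n - 1) = q ^ n" using n by (simp flip: power_Suc)
  hence "a * c 0 + - (q * a) * c (n - 1) = a * (c 0 * (1 - q ^ n))"
    using geo[of "n - 1"] n by (simp add: algebra_simps)
  also have "\<dots> = 1" using ne by (simp add: a_def)
  finally have "a * c 0 + - (q * a) * c (n - 1) = 1" .
  moreover have "\<forall>d<n - 1. a * c (d + 1) + - (q * a) * c d = 0"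
  proof (intro allI impI)
    fix d assume "d < n - 1"
    hence "c d = c 0 * q ^ d" "c (d + 1) = c 0 * q ^ (d + 1)"
      by (intro geo; simp)+
    thus "a * c (d + 1) + - (q * a) * c d = 0" by simp
  qed
  moreover have "a < - (- (q * a))" using a q by simp
  ultimately show ?L using a by blast
qed

theorem theorem3p6:
  fixes n :: nat and \<alpha> :: "nat \<Rightarrow> real" and Z A :: "real mat"
  assumes "n \<ge> 2"
    and "Z = mat_of_cols n (unit_vec n (n - 1) # map (unit_vec n) [0..<n - 1])"
    and "\<forall>k\<in>{1..n}. \<alpha> k \<le> 0"
    and "A = finsum (ring_mat TYPE(real) n ()) (\<lambda>k. \<alpha> k \<cdot>\<^sub>m (Z ^\<^sub>m (k - 1))) {1..n}"
  shows "(invertible_mat A \<and>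
           (\<exists>C \<in> carrier_mat n n. inverts_mat A C \<and> inverts_mat C A \<and>
              N_matrix n C \<and> digraph_of_mat n C = cycle_with_loops n))
     \<longleftrightarrow>
         (neg_mat A \<and>
          \<alpha> 2 < \<alpha> 1 \<and> \<alpha> 1 < 0 \<and>
          (\<forall>r\<in>{3..n}. \<alpha> r = (\<alpha> 2) ^ (r - 1) / (\<alpha> 1) ^ (r - 2)))"
    (is "?inverse \<longleftrightarrow> _")
proof -
  note n = \<open>n \<ge> 2\<close>
  define c where "c = (\<lambda>d. \<alpha> (d + 1))"
  have A_eq: "A = finsum (ring_mat TYPE(real) n ())
      (\<lambda>k. \<alpha> k \<cdot>\<^sub>m (cyclic_shift n ^\<^sub>m (k - 1))) {1..n}"
    using assms(2,4) mat_of_cols_unit_vecs_eq_cyclic_shift[OF n] by simp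
  have "n > 0" using n by simp
  note entries = shift_polynomial_index[OF this, where \<alpha> = \<alpha>, folded A_eq]
  have A: "A \<in> carrier_mat n n"
    by (rule entries(1))
  have A_index: "A $$ (i, j) = c ((j + n - i) mod n)" if "i < n" "j < n" for i j
    unfolding c_def by (rule entries(2)[OF that])
  have product_iff: "shift_pencil n a b * A = 1\<^sub>m n \<longleftrightarrow>
      a * c 0 + b * c (n - 1) = 1 \<and> (\<forall>d<n - 1. a * c (d + 1) + b * c d = 0)" for a b
    by (rule shift_pencil_mult_circulant_eq_one_iff[OF n A]) (rule A_index)
  have "?inverse \<longleftrightarrow> (\<exists>a b. 0 < a \<and> a < - b \<and> shift_pencil n a b * A = 1\<^sub>m n)"
  proof
    assume ?inverse
    then obtain C where C: "C \<in> carrier_mat n n" "A * C = 1\<^sub>m n" "C * A = 1\<^sub>m n"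
      "N_matrix n C" "digraph_of_mat n C = cycle_with_loops n"
      using A by (auto simp: inverts_mat_def)
    have "shift_invariant n C"
      using shift_invariant_inverse[OF A C(1-3)] shift_invariantI_index[OF A_index] by blast
    from shift_invariant_cycle_eq_pencil[OF n C(1) this C(5)]
    obtain a b where "C = shift_pencil n a b" by blast
    thus "\<exists>a b. 0 < a \<and> a < - b \<and> shift_pencil n a b * A = 1\<^sub>m n"
      using C(3,4) N_matrix_shift_pencil_iff[OF n] by blast
  next
    assume "\<exists>a b. 0 < a \<and> a < - b \<and> shift_pencil n a b * A = 1\<^sub>m n"
    then obtain a b where ab: "0 < a" "a < - b" and left: "shift_pencil n a b * A = 1\<^sub>m n"
      by blast
    have right: "A * shift_pencil n a b = 1\<^sub>m n"
      by (rule mat_mult_left_right_inverse[OF _ A left]) simp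
    have inv: "inverts_mat A (shift_pencil n a b)" "inverts_mat (shift_pencil n a b) A"
      using left right A by (auto simp: inverts_mat_def)
    moreover have "invertible_mat A"
      using inv A unfolding invertible_mat_def by auto
    moreover have "digraph_of_mat n (shift_pencil n a b) = cycle_with_loops n"
      using ab by (intro digraph_shift_pencil[OF n]) auto
    moreover have "N_matrix n (shift_pencil n a b)"
      using N_matrix_shift_pencil_iff[OF n] ab by simp
    ultimately show ?inverse using shift_pencil_carrier(1) by blast
  qed
  also have "\<dots> \<longleftrightarrow> c 1 < c 0 \<and> c 0 < 0 \<and> (\<forall>d<n. c d = c 0 * (c 1 / c 0) ^ d)"
    unfolding product_iff by (rule pencil_equations_solvable_iff[OF n])
  also have "\<dots> \<longleftrightarrow> neg_mat A \<and> c 1 < c 0 \<and> c 0 < 0 \<and> (\<forall>d<n. c d = c 0 * (c 1 / c 0) ^ d)"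
  proof -
    have "neg_mat A" if "c 1 < c 0" "c 0 < 0" "\<forall>d<n. c d = c 0 * (c 1 / c 0) ^ d"
    proof -
      have "c 1 / c 0 > 0" using that(1,2) by (intro divide_neg_neg) auto
      hence prod_neg: "c 0 * (c 1 / c 0) ^ d < 0" for d
        using that(2) by (intro mult_neg_pos zero_less_power)
      have "c d < 0" if "d < n" for d
        using prod_neg[of d] \<open>\<forall>d<n. c d = c 0 * (c 1 / c 0) ^ d\<close> that by metis
      hence "A $$ (i, j) < 0" if "i < n" "j < n" for i j
        using A_index that by simp
      thus ?thesis using A unfolding neg_mat_def by (auto dest!: elements_matD)
    qed
    thus ?thesis by blast
  qed
  also have "\<dots> \<longleftrightarrow> neg_mat A \<and> \<alpha> 2 < \<alpha> 1 \<and> \<alpha> 1 < 0 \<and>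
      (\<forall>r\<in>{3..n}. \<alpha> r = (\<alpha> 2) ^ (r - 1) / (\<alpha> 1) ^ (r - 2))"
  proof -
    have c: "c 0 = \<alpha> 1" "c 1 = \<alpha> 2" by (simp_all add: c_def numeral_2_eq_2)
    have "(\<forall>d<n. c d = \<alpha> 1 * (\<alpha> 2 / \<alpha> 1) ^ d) \<longleftrightarrow>
        (\<forall>r\<in>{3..n}. \<alpha> r = (\<alpha> 2) ^ (r - 1) / (\<alpha> 1) ^ (r - 2))" if "\<alpha> 1 < 0"
    proof -
      have pow: "\<alpha> 1 * (\<alpha> 2 / \<alpha> 1) ^ Suc d = (\<alpha> 2) ^ Suc d / (\<alpha> 1) ^ d" for d
        using that by (simp add: power_divide)
      show ?thesis
      proof
        assume geo: "\<forall>d<n. c d = \<alpha> 1 * (\<alpha> 2 / \<alpha> 1) ^ d"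
        show "\<forall>r\<in>{3..n}. \<alpha> r = (\<alpha> 2) ^ (r - 1) / (\<alpha> 1) ^ (r - 2)"
        proof
          fix r assume r: "r \<in> {3..n}"
          hence r': "Suc (r - 2) = r - 1" "r - 1 < n" "r - 1 + 1 = r" by auto
          have "\<alpha> r = c (r - 1)" by (simp only: c_def r'(3))
          also have "\<dots> = \<alpha> 1 * (\<alpha> 2 / \<alpha> 1) ^ (r - 1)" using geo r'(2) by blast
          also have "\<dots> = (\<alpha> 2) ^ (r - 1) / (\<alpha> 1) ^ (r - 2)"
            using pow[of "r - 2"] by (simp only: r'(1))
          finally show "\<alpha> r = (\<alpha> 2) ^ (r - 1) / (\<alpha> 1) ^ (r - 2)" .
        qed
      next
        assume quot: "\<forall>r\<in>{3..n}. \<alpha> r = (\<alpha> 2) ^ (r - 1) / (\<alpha> 1) ^ (r - 2)"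
        show "\<forall>d<n. c d = \<alpha> 1 * (\<alpha> 2 / \<alpha> 1) ^ d"
        proof (intro allI impI)
          fix d assume d: "d < n"
          consider "d = 0" | "d = 1" | "d + 1 \<in> {3..n}" using d by fastforce
          thus "c d = \<alpha> 1 * (\<alpha> 2 / \<alpha> 1) ^ d"
          proof cases
            case 3
            hence d': "Suc (d - 1) = d" "d + 1 - 1 = d" "d + 1 - 2 = d - 1" by auto
            have "c d = (\<alpha> 2) ^ d / (\<alpha> 1) ^ (d - 1)"
              using bspec[OF quot 3] unfolding d'(2,3) c_def .
            thus ?thesis using pow[of "d - 1"] by (simp only: d'(1))
          qed (use c that in auto)
        qed
      qed
    qed
    thus ?thesis unfolding c by blast
  qed
  finally show ?thesis .
qed

end
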